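(* Let $d\ge2$ and let $V_1,\dots,V_n$ be pairwise distinct linear subspaces of $\mathbb{R}^d$ with $1\le\dim(V_j)\le d-1$ for all $j$ (not necessarily of the same dimension). If $\{V_j\}_{j=1}^n$ is equiangular, then $n\le\binom{d+1}{2}$.
   Context: For a linear subspace $V\subset\mathbb{R}^d$, $P_V$ denotes the orthogonal projection of $\mathbb{R}^d$ onto $V$, and $\langle P,Q\rangle:=\operatorname{trace}(PQ)$ for self-adjoint operators $P,Q$. The collection $\{V_j\}_{j=1}^n$ is called equiangular if $\langle P_{V_i},P_{V_j}\rangle$ takes the same value for all $i\ne j$. *)

theory Defs
  imports "HOL-Analysis.Analysis"
begin

definition orth_proj :: "'a::euclidean_space set \<Rightarrow> 'a \<Rightarrow> 'a" where
  "orth_proj V x = (THE y. y \<in> V \<and> (\<forall>v\<in>V. orthogonal (x - y) v))"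

lemma orth_proj_ex1:
  fixes V :: "'a::euclidean_space set"
  assumes "subspace V"
  shows "\<exists>!y. y \<in> V \<and> (\<forall>v\<in>V. orthogonal (x - y) v)"
proof -
  obtain y z where y: "y \<in> span V" and z: "\<And>w. w \<in> span V \<Longrightarrow> orthogonal z w" and x: "x = y + z"
    using orthogonal_subspace_decomp_exists[of V x] by metis
  show ?thesis
  proof (rule ex1I)
    show "y \<in> V \<and> (\<forall>v\<in>V. orthogonal (x - y) v)"
      using y z x assms by (metis add_diff_cancel_left' span_eq_iff)
  next
    fix y' assume y': "y' \<in> V \<and> (\<forall>v\<in>V. orthogonal (x - y') v)"
    have yV: "y \<in> V" using y assms by (metis span_eq_iff)
    have d: "y' - y \<in> V" using y' yV assms by (simp add: subspace_diff)
    have 1: "(x - y') \<bullet> (y' - y) = 0" using y' d by (simp add: orthogonal_def)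
    have 2: "(x - y) \<bullet> (y' - y) = 0"
      using z[of "y' - y"] x d by (simp add: orthogonal_def span_base)
    have "(y' - y) \<bullet> (y' - y) = (x - y) \<bullet> (y' - y) - (x - y') \<bullet> (y' - y)"
      by (simp add: algebra_simps)
    then show "y' = y" using 1 2 by simp
  qed
qed

lemma orth_proj_eqI:
  assumes "subspace V" "y \<in> V" "\<And>v. v \<in> V \<Longrightarrow> orthogonal (x - y) v"
  shows "orth_proj V x = y"
  unfolding orth_proj_def using orth_proj_ex1[OF assms(1)] assms(2,3)
  by (intro the1_equality) auto

lemma orth_proj_in: "subspace V \<Longrightarrow> orth_proj V x \<in> V"
  and orth_proj_orthogonal: "subspace V \<Longrightarrow> v \<in> V \<Longrightarrow> orthogonal (x - orth_proj V x) v"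
  unfolding orth_proj_def using theI'[OF orth_proj_ex1, of V x] by blast+

lemma linear_orth_proj:
  assumes "subspace V"
  shows "linear (orth_proj V)"
proof (rule linearI)
  fix x y
  show "orth_proj V (x + y) = orth_proj V x + orth_proj V y"
  proof (rule orth_proj_eqI[OF assms])
    fix v assume "v \<in> V"
    then show "orthogonal (x + y - (orth_proj V x + orth_proj V y)) v"
      using orth_proj_orthogonal[OF assms, of v x] orth_proj_orthogonal[OF assms, of v y]
      by (simp add: orthogonal_def inner_diff_left inner_add_left)
  qed (simp add: assms orth_proj_in subspace_add)
next
  fix r x
  show "orth_proj V (r *\<^sub>R x) = r *\<^sub>R orth_proj V x"
  proof (rule orth_proj_eqI[OF assms])
    fix v assume "v \<in> V"
    then show "orthogonal (r *\<^sub>R x - r *\<^sub>R orth_proj V x) v"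
      using orth_proj_orthogonal[OF assms, of v x]
      by (simp add: orthogonal_def inner_diff_left)
  qed (simp add: assms orth_proj_in subspace_scale)
qed

text \<open>The trace of an operator is the trace of its matrix in the standard basis; only
  linear arguments (in fact, self-adjoint ones) are of interest.\<close>

definition trace_inner :: "(real^'d \<Rightarrow> real^'d) \<Rightarrow> (real^'d \<Rightarrow> real^'d) \<Rightarrow> real" where
  "trace_inner P Q = trace (matrix (P \<circ> Q))"

definition equiangular :: "'i set \<Rightarrow> ('i \<Rightarrow> (real^'d) set) \<Rightarrow> bool" where
  "equiangular I V \<longleftrightarrow>
     (\<exists>c. \<forall>i\<in>I. \<forall>j\<in>I. i \<noteq> j \<longrightarrow> trace_inner (orth_proj (V i)) (orth_proj (V j)) = c)"

end

theory Submission
  imports Defs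
begin

text \<open>
  The matrices of the orthogonal projections \<open>P\<^sub>i\<close> onto the \<open>V i\<close> are symmetric, and on symmetric
  matrices the trace form is the Euclidean inner product of the entries. The symmetric matrices form
  a space of dimension at most \<open>(d + 1) choose 2\<close>, so it suffices that the \<open>n\<close> projections are
  linearly independent.

  Let \<open>c\<close> be the common value of \<open>\<langle>P\<^sub>i, P\<^sub>j\<rangle>\<close> for \<open>i \<noteq> j\<close>. Two facts about a pair of projections
  come from writing \<open>\<langle>P\<^sub>V, P\<^sub>W\<rangle>\<close> as a sum of squares, namely the squared Hilbert-Schmidt norm of
  \<open>P\<^sub>V P\<^sub>W\<close>: firstly \<open>c \<ge> 0\<close>; secondly, by Pythagoras, \<open>\<langle>P\<^sub>V, P\<^sub>W\<rangle> \<le> \<langle>P\<^sub>W, P\<^sub>W\<rangle>\<close>, with equality only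
  if \<open>W \<subseteq> V\<close>. Since the subspaces are distinct, \<open>\<langle>P\<^sub>i, P\<^sub>i\<rangle> = c\<close> holds for at most one \<open>i\<close>: two such
  subspaces would contain each other. The Gram matrix is therefore the sum of \<open>c\<close> times the all-ones
  matrix and a nonnegative diagonal matrix with at most one zero on the diagonal. If
  \<open>\<Sum>i. a i * P\<^sub>i = 0\<close>, then
  \<open>0 = c * (\<Sum>i. a i)\<^sup>2 + (\<Sum>i. (\<langle>P\<^sub>i, P\<^sub>i\<rangle> - c) * (a i)\<^sup>2)\<close>,
  so every term vanishes. This kills all coefficients but possibly one, and the remaining one
  vanishes because no projection is zero.
\<close>

section \<open>Orthogonal projections and the trace form\<close>

lemma orth_proj_fixes:
  assumes "subspace V" "x \<in> V"
  shows "orth_proj V x = x"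
  using assms by (intro orth_proj_eqI) (auto simp: orthogonal_def)

lemma orth_proj_idem: "subspace V \<Longrightarrow> orth_proj V (orth_proj V x) = orth_proj V x"
  by (simp add: orth_proj_fixes orth_proj_in)

lemma orth_proj_self_adjoint:
  assumes "subspace V"
  shows "orth_proj V x \<bullet> y = x \<bullet> orth_proj V y"
proof -
  have "(x - orth_proj V x) \<bullet> orth_proj V y = 0" "(y - orth_proj V y) \<bullet> orth_proj V x = 0"
    using orth_proj_orthogonal[OF assms orth_proj_in[OF assms]] by (auto simp: orthogonal_def)
  then show ?thesis
    by (simp add: inner_diff_left inner_diff_right inner_commute)
qed

lemma inner_orth_proj_eq_norm:
  assumes "subspace V"
  shows "orth_proj V x \<bullet> x = (norm (orth_proj V x))\<^sup>2"
  using orth_proj_self_adjoint[OF assms, of "orth_proj V x" x]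
  by (simp add: orth_proj_idem[OF assms] power2_norm_eq_inner)

lemma symmetric_matrix_orth_proj:
  assumes "subspace V"
  shows "transpose (matrix (orth_proj V)) = (matrix (orth_proj V) :: real^'d^'d)"
  using orth_proj_self_adjoint[OF assms, of "axis _ 1" "axis _ 1"]
  by (simp add: vec_eq_iff transpose_def matrix_def inner_axis inner_axis')

lemma trace_matrix_eq_sum_inner: "trace (matrix f) = (\<Sum>b\<in>UNIV. f (axis b 1) \<bullet> axis b 1)"
  for f :: "real^'d \<Rightarrow> real^'d"
  by (simp add: trace_def matrix_def inner_axis)

lemma inner_matrix_eq_sum_inner:
  fixes f g :: "real^'d \<Rightarrow> real^'d"
  shows "matrix f \<bullet> matrix g = (\<Sum>b\<in>UNIV. f (axis b 1) \<bullet> g (axis b 1))"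
  unfolding inner_vec_def matrix_def by (simp, subst sum.swap, rule refl)

lemma trace_inner_eq_inner_matrix:
  fixes V W :: "(real^'d) set"
  assumes "subspace V"
  shows "trace_inner (orth_proj V) (orth_proj W) = matrix (orth_proj V) \<bullet> matrix (orth_proj W)"
  unfolding trace_inner_def trace_matrix_eq_sum_inner inner_matrix_eq_sum_inner
  by (simp add: orth_proj_self_adjoint[OF assms] inner_commute[of "orth_proj W _"])

text \<open>Cyclicity of the trace gives \<open>tr (P\<^sub>V P\<^sub>W) = tr (P\<^sub>V P\<^sub>W P\<^sub>W) = tr (P\<^sub>W P\<^sub>V P\<^sub>W)\<close>, and the last
  operator is \<open>(P\<^sub>V P\<^sub>W)\<^sup>* (P\<^sub>V P\<^sub>W)\<close>.\<close>

lemma trace_inner_orth_proj_eq_sum_norm: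
  fixes V W :: "(real^'d) set"
  assumes V: "subspace V" and W: "subspace W"
  shows "trace_inner (orth_proj V) (orth_proj W) =
           (\<Sum>b\<in>UNIV. (norm (orth_proj V (orth_proj W (axis b 1))))\<^sup>2)"
proof -
  let ?P = "orth_proj V" and ?Q = "orth_proj W"
  have lin: "linear ?P" "linear ?Q"
    using V W by (simp_all add: linear_orth_proj)
  have "?P \<circ> ?Q = (?P \<circ> ?Q) \<circ> ?Q"
    by (simp add: fun_eq_iff orth_proj_idem[OF W])
  then have "trace_inner ?P ?Q = trace (matrix ((?P \<circ> ?Q) \<circ> ?Q))"
    by (simp add: trace_inner_def)
  also have "\<dots> = trace (matrix (?Q \<circ> (?P \<circ> ?Q)))"
    unfolding matrix_compose[OF lin(2) linear_compose[OF lin(2,1)]]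
      matrix_compose[OF linear_compose[OF lin(2,1)] lin(2)] by (rule trace_mul_sym)
  also have "\<dots> = (\<Sum>b\<in>UNIV. (norm (?P (?Q (axis b 1))))\<^sup>2)"
    by (simp add: trace_matrix_eq_sum_inner orth_proj_self_adjoint[OF W]
        inner_orth_proj_eq_norm[OF V])
  finally show ?thesis .
qed

lemma trace_inner_orth_proj_nonneg:
  fixes V W :: "(real^'d) set"
  assumes "subspace V" "subspace W"
  shows "0 \<le> trace_inner (orth_proj V) (orth_proj W)"
  by (simp add: trace_inner_orth_proj_eq_sum_norm[OF assms] sum_nonneg)

lemma trace_inner_orth_proj_defect:
  fixes V W :: "(real^'d) set"
  assumes V: "subspace V" and W: "subspace W"
  shows "trace_inner (orth_proj W) (orth_proj W) - trace_inner (orth_proj V) (orth_proj W) =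
           (\<Sum>b\<in>UNIV. (norm (orth_proj W (axis b 1) - orth_proj V (orth_proj W (axis b 1))))\<^sup>2)"
proof -
  have pythagoras: "(norm (x - orth_proj V x))\<^sup>2 = (norm x)\<^sup>2 - (norm (orth_proj V x))\<^sup>2" for x
    using inner_orth_proj_eq_norm[OF V, of x]
    by (simp add: power2_norm_eq_inner inner_diff_left inner_diff_right inner_commute)
  show ?thesis
    by (simp add: trace_inner_orth_proj_eq_sum_norm V W orth_proj_idem pythagoras sum_subtractf)
qed

lemma trace_inner_orth_proj_le:
  fixes V W :: "(real^'d) set"
  assumes "subspace V" "subspace W"
  shows "trace_inner (orth_proj V) (orth_proj W) \<le> trace_inner (orth_proj W) (orth_proj W)"
  using trace_inner_orth_proj_defect[OF assms]
  by (smt (verit, best) sum_nonneg zero_le_power2)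

text \<open>A vanishing defect means that \<open>P\<^sub>V\<close> fixes the images under \<open>P\<^sub>W\<close> of the basis vectors, which
  span \<open>W\<close>.\<close>

lemma trace_inner_orth_proj_eq_imp_subset:
  fixes V W :: "(real^'d) set"
  assumes V: "subspace V" and W: "subspace W"
    and eq: "trace_inner (orth_proj V) (orth_proj W) = trace_inner (orth_proj W) (orth_proj W)"
  shows "W \<subseteq> V"
proof
  fix x assume x: "x \<in> W"
  have "orth_proj W (axis b 1) = orth_proj V (orth_proj W (axis b 1))" for b
    using trace_inner_orth_proj_defect[OF V W] eq by (simp add: sum_nonneg_eq_0_iff)
  then have "orth_proj W = orth_proj V \<circ> orth_proj W"
    using V W by (intro linear_eq_stdbasis linear_compose linear_orth_proj)
      (auto simp: Basis_vec_def)
  then have "orth_proj V x = x"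
    using orth_proj_fixes[OF W x] by (metis comp_apply)
  then show "x \<in> V"
    using orth_proj_in[OF V] by metis
qed

lemma matrix_orth_proj_nonzero:
  fixes V :: "(real^'d) set"
  assumes "subspace V" "x \<in> V" "x \<noteq> 0"
  shows "matrix (orth_proj V) \<noteq> 0"
  using matrix_vector_mul(2)[OF linear_orth_proj[OF assms(1)]] orth_proj_fixes[OF assms(1,2)]
    assms(3) by (metis matrix_vector_mult_0)

section \<open>The dimension of the space of symmetric matrices\<close>

text \<open>A symmetric matrix is a function on the unordered pairs \<open>{i, j}\<close>, and these are the subsets of
  the index set with one or two elements. The indicator matrices of the pairs span.\<close>

lemma dim_symmetric_matrices_le:
  "dim {A :: real^'d^'d. transpose A = A} \<le> (CARD('d) + 1) choose 2"
proof -
  define E :: "'d set \<Rightarrow> real^'d^'d" where "E S = (\<chi> i j. if S = {i, j} then 1 else 0)" for S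
  define U :: "'d set set" where "U = {S. card S = 1} \<union> {S. card S = 2}"
  have fin: "finite U" by simp
  have pair: "{i, j} \<in> U" for i j
    by (simp add: U_def card_insert_if)
  have "card U = (CARD('d) choose 1) + (CARD('d) choose 2)"
    unfolding U_def using n_subsets[of "UNIV :: 'd set" 1] n_subsets[of "UNIV :: 'd set" 2]
    by (subst card_Un_disjoint) auto
  then have cardU: "card U = (CARD('d) + 1) choose 2"
    by (simp add: numeral_2_eq_2)
  have "{A :: real^'d^'d. transpose A = A} \<subseteq> span (E ` U)"
  proof
    fix A :: "real^'d^'d" assume "A \<in> {A. transpose A = A}"
    then have sym: "A $ i $ j = A $ j $ i" for i j
      by (auto simp: transpose_def vec_eq_iff)
    define f where "f S = (SOME r. \<exists>i j. S = {i, j} \<and> r = A $ i $ j)" for S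
    have f: "f {i, j} = A $ i $ j" for i j
      unfolding f_def by (rule some_equality) (auto simp: doubleton_eq_iff sym)
    have "A = (\<Sum>S\<in>U. f S *\<^sub>R E S)"
      using fin pair by (simp add: vec_eq_iff E_def f if_distrib sum.delta cong: if_cong)
    also have "\<dots> \<in> span (E ` U)"
      by (intro span_sum span_scale span_base) auto
    finally show "A \<in> span (E ` U)" .
  qed
  then have "dim {A :: real^'d^'d. transpose A = A} \<le> card (E ` U)"
    using fin by (intro dim_le_card) auto
  also have "\<dots> \<le> card U"
    using fin by (rule card_image_le)
  finally show ?thesis
    by (simp add: cardU)
qed

section \<open>Vectors with constant mutual inner products\<close>

text \<open>The squared norm of the combination is \<open>c * (\<Sum>i. a i)\<^sup>2 + (\<Sum>i. (v i \<bullet> v i - c) * (a i)\<^sup>2)\<close>. A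
  coefficient that escapes the second sum is the only nonzero one, so it multiplies a nonzero vector
  to give zero.\<close>

lemma constant_inner_family_coeff_zero:
  fixes v :: "'i \<Rightarrow> 'a::real_inner"
  assumes fin: "finite I" and c: "0 \<le> c"
    and off: "\<And>i j. i \<in> I \<Longrightarrow> j \<in> I \<Longrightarrow> i \<noteq> j \<Longrightarrow> v i \<bullet> v j = c"
    and diag: "\<And>i. i \<in> I \<Longrightarrow> c \<le> v i \<bullet> v i"
    and uniq: "\<And>i j. i \<in> I \<Longrightarrow> j \<in> I \<Longrightarrow> v i \<bullet> v i = c \<Longrightarrow> v j \<bullet> v j = c \<Longrightarrow> i = j"
    and nz: "\<And>i. i \<in> I \<Longrightarrow> v i \<noteq> 0"
    and comb: "(\<Sum>i\<in>I. a i *\<^sub>R v i) = 0" and k: "k \<in> I"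
  shows "a k = 0"
proof -
  have entry: "v i \<bullet> v j = c + (if i = j then v i \<bullet> v i - c else 0)" if "i \<in> I" "j \<in> I" for i j
    using off that by auto
  have "0 = (\<Sum>i\<in>I. a i *\<^sub>R v i) \<bullet> (\<Sum>j\<in>I. a j *\<^sub>R v j)"
    using comb by simp
  also have "\<dots> = (\<Sum>j\<in>I. \<Sum>i\<in>I. a i * a j * (v i \<bullet> v j))"
    by (simp add: inner_sum_left inner_sum_right sum_distrib_left mult_ac)
  also have "\<dots> = (\<Sum>j\<in>I. \<Sum>i\<in>I. c * (a i * a j) + (if i = j then (v i \<bullet> v i - c) * (a i)\<^sup>2 else 0))"
    by (intro sum.cong refl) (subst entry, auto simp: algebra_simps power2_eq_square)
  also have "\<dots> = c * (\<Sum>i\<in>I. a i)\<^sup>2 + (\<Sum>i\<in>I. (v i \<bullet> v i - c) * (a i)\<^sup>2)"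
    using fin by (simp add: sum.distrib sum.delta power2_eq_square sum_product sum_distrib_left mult_ac)
  finally have "c * (\<Sum>i\<in>I. a i)\<^sup>2 + (\<Sum>i\<in>I. (v i \<bullet> v i - c) * (a i)\<^sup>2) = 0"
    by simp
  moreover have "0 \<le> c * (\<Sum>i\<in>I. a i)\<^sup>2"
    using c by simp
  moreover have nonneg: "0 \<le> (v i \<bullet> v i - c) * (a i)\<^sup>2" if "i \<in> I" for i
    using diag[OF that] by simp
  ultimately have "(\<Sum>i\<in>I. (v i \<bullet> v i - c) * (a i)\<^sup>2) = 0"
    using sum_nonneg[of I "\<lambda>i. (v i \<bullet> v i - c) * (a i)\<^sup>2"] by fastforce
  then have zero: "v i \<bullet> v i = c \<or> a i = 0" if "i \<in> I" for i
    using fin nonneg that by (auto simp: sum_nonneg_eq_0_iff)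
  show ?thesis
  proof (rule ccontr)
    assume ak: "a k \<noteq> 0"
    have "a i = 0" if "i \<in> I - {k}" for i
      using zero[of i] zero[OF k] uniq[of i k] k ak that by auto
    then have "(\<Sum>i\<in>I. a i *\<^sub>R v i) = a k *\<^sub>R v k"
      using fin k by (simp add: sum.remove)
    with comb nz[OF k] ak show False by simp
  qed
qed

lemma constant_inner_family_card_le_dim:
  fixes v :: "'i \<Rightarrow> 'a::euclidean_space"
  assumes fin: "finite I" and c: "0 \<le> c"
    and off: "\<And>i j. i \<in> I \<Longrightarrow> j \<in> I \<Longrightarrow> i \<noteq> j \<Longrightarrow> v i \<bullet> v j = c"
    and diag: "\<And>i. i \<in> I \<Longrightarrow> c \<le> v i \<bullet> v i"
    and uniq: "\<And>i j. i \<in> I \<Longrightarrow> j \<in> I \<Longrightarrow> v i \<bullet> v i = c \<Longrightarrow> v j \<bullet> v j = c \<Longrightarrow> i = j"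
    and nz: "\<And>i. i \<in> I \<Longrightarrow> v i \<noteq> 0"
    and sub: "v ` I \<subseteq> S"
  shows "card I \<le> dim S"
proof -
  have inj: "inj_on v I"
    by (rule inj_onI) (metis off uniq)
  have "independent (v ` I)"
  proof (rule independent_if_scalars_zero)
    show "finite (v ` I)" using fin by simp
    fix f x assume f: "(\<Sum>x\<in>v ` I. f x *\<^sub>R x) = 0" and "x \<in> v ` I"
    then obtain k where k: "k \<in> I" "x = v k" by auto
    have "(\<Sum>i\<in>I. f (v i) *\<^sub>R v i) = 0"
      using f by (simp add: sum.reindex[OF inj])
    then show "f x = 0"
      unfolding k(2) using k(1)
      by (intro constant_inner_family_coeff_zero[where v = v and I = I and c = c and a = "\<lambda>i. f (v i)"])
        (auto simp: fin c off diag nz intro: uniq)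
  qed
  then have "card (v ` I) \<le> dim S"
    by (rule independent_card_le_dim[OF sub])
  then show ?thesis
    by (simp add: card_image[OF inj])
qed

section \<open>The bound for equiangular subspaces\<close>

theorem theorem3p6:
  fixes V :: "nat \<Rightarrow> (real^'d) set" and n :: nat
  assumes "CARD('d) \<ge> 2"
    and "\<And>j. j \<in> {1..n} \<Longrightarrow> subspace (V j)"
    and "inj_on V {1..n}"
    and "\<And>j. j \<in> {1..n} \<Longrightarrow> 1 \<le> dim (V j) \<and> dim (V j) \<le> CARD('d) - 1"
    and "equiangular {1..n} V"
  shows "n \<le> (CARD('d) + 1) choose 2"
proof (cases "n \<le> 1")
  case True
  have "0 < (CARD('d) + 1) choose 2"
    using assms(1) by (intro zero_less_binomial) simp
  with True show ?thesis by linarith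
next
  \<comment> \<open>Only with two indices is \<open>c\<close> an actual value of the trace form, and hence nonnegative.\<close>
  case False
  let ?I = "{1..n}"
  define M where "M i = (matrix (orth_proj (V i)) :: real^'d^'d)" for i
  note sub = assms(2)
  obtain c where "\<forall>i\<in>?I. \<forall>j\<in>?I. i \<noteq> j \<longrightarrow> trace_inner (orth_proj (V i)) (orth_proj (V j)) = c"
    using assms(5) unfolding equiangular_def by (rule exE)
  then have c: "trace_inner (orth_proj (V i)) (orth_proj (V j)) = c"
    if "i \<in> ?I" "j \<in> ?I" "i \<noteq> j" for i j
    using that by simp
  have inner: "M i \<bullet> M j = trace_inner (orth_proj (V i)) (orth_proj (V j))" if "i \<in> ?I" for i j
    using trace_inner_eq_inner_matrix[OF sub[OF that]] by (simp add: M_def)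
  have other: "\<exists>j\<in>?I. j \<noteq> i" for i
    using False by (intro bexI[of _ "if i = 1 then 2 else 1"]) auto
  have "card ?I \<le> dim {A :: real^'d^'d. transpose A = A}"
  proof (rule constant_inner_family_card_le_dim[where v = M and c = c])
    show "finite ?I" by simp
    show "0 \<le> c"
      using c[of 1 2] trace_inner_orth_proj_nonneg[OF sub sub, of 1 2] False by simp
    show "M i \<bullet> M j = c" if "i \<in> ?I" "j \<in> ?I" "i \<noteq> j" for i j
      using c inner that by simp
    show "c \<le> M i \<bullet> M i" if "i \<in> ?I" for i
      using other[of i] c trace_inner_orth_proj_le[OF sub sub] inner that by metis
    show "i = j" if "i \<in> ?I" "j \<in> ?I" "M i \<bullet> M i = c" "M j \<bullet> M j = c" for i j
    proof (rule ccontr)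
      assume "i \<noteq> j"
      then have "V i \<subseteq> V j" "V j \<subseteq> V i"
        using trace_inner_orth_proj_eq_imp_subset[OF sub sub] c inner that by metis+
      then have "V i = V j" by (rule subset_antisym)
      then show False
        using inj_onD[OF assms(3) _ that(1,2)] \<open>i \<noteq> j\<close> by blast
    qed
    show "M i \<noteq> 0" if "i \<in> ?I" for i
    proof -
      have "\<not> V i \<subseteq> {0}"
        using assms(4)[OF that] dim_eq_0[of "V i"] by linarith
      then show ?thesis
        using matrix_orth_proj_nonzero[OF sub[OF that]] by (auto simp: M_def)
    qed
    show "M ` ?I \<subseteq> {A. transpose A = A}"
      using sub by (auto simp: M_def symmetric_matrix_orth_proj)
  qed
  also note dim_symmetric_matrices_le
  finally show ?thesis by simp
qed

end
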